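(* Let $X$ be a set and let $\mathscr{A}$ and $\mathscr{B}$ be collections of families of subsets of $X$. Then: 1. If $X$ satisfies the principle $\mathbf{SS}_1^*(\mathscr{A},\mathscr{B})$, then $X$ satisfies the principle $\mathbf{SCS}_1(\mathscr{A},\mathscr{R}_{\mathscr{B}}^-)$. 2. If $X$ satisfies the principle $\mathbf{SCS}_1(\mathscr{A},\mathscr{B})$, then $X$ satisfies the principle $\mathbf{SS}_1^*(\mathscr{A},\mathscr{R}_{\mathscr{B}}^+)$. 3. If $X$ satisfies the principle $\mathbf{SS}_{fin}^*(\mathscr{A},\mathscr{B})$, then $X$ satisfies the principle $\mathbf{SCS}_{fin}(\mathscr{A},\mathscr{R}_{\mathscr{B}}^-)$. 4. If $X$ satisfies the principle $\mathbf{SCS}_{fin}(\mathscr{A},\mathscr{B})$, then $X$ satisfies the principle $\mathbf{SS}_{fin}^*(\mathscr{A},\mathscr{R}_{\mathscr{B}}^+)$.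
   Context: For a set $Y$, $[Y]^{<\omega}$ is the collection of all finite subsets of $Y$ (including $\emptyset$; $\bigcup\emptyset=\emptyset$). For $A\subseteq X$ and a family $\mathcal{U}$ of subsets of $X$, $St(A,\mathcal{U})=\bigcup\{U\in\mathcal{U}:U\cap A\neq\emptyset\}$, and $St(x,\mathcal{U})=St(\{x\},\mathcal{U})$ for $x\in X$. For families $\mathcal{A},\mathcal{B}$ of sets, $\mathcal{A}$ refines $\mathcal{B}$, written $\mathcal{A}\prec\mathcal{B}$, if for every $A\in\mathcal{A}$ there is $B\in\mathcal{B}$ with $A\subseteq B$. For a collection $\mathscr{B}$ of families of subsets of $X$, with $\mathcal{R}$ ranging over families of subsets of $X$, $\mathscr{R}_{\mathscr{B}}^-=\{\mathcal{R}:\text{there exists }\mathcal{B}\in\mathscr{B}\text{ such that }\mathcal{R}\prec\mathcal{B}\}$ and $\mathscr{R}_{\mathscr{B}}^+=\{\mathcal{R}:\text{there exists }\mathcal{B}\in\mathscr{B}\text{ such that }\mathcal{B}\prec\mathcal{R}\}$. For collections $\mathscr{A},\mathscr{B}$ of families of subsets of $X$: $\mathbf{SS}^*_1(\mathscr{A},\mathscr{B})$: for any sequence $\{\mathcal{A}_n:n\in\omega\}$ of elements of $\mathscr{A}$ there is a sequence $\{x_n:n\in\omega\}$ of points of $X$ such that $\{St(x_n,\mathcal{A}_n):n\in\omega\}\in\mathscr{B}$. $\mathbf{SS}^*_{fin}(\mathscr{A},\mathscr{B})$: for any sequence $\{\mathcal{A}_n:n\in\omega\}$ of elements of $\mathscr{A}$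 there is a sequence $\{K_n:n\in\omega\}$ of finite subsets of $X$ such that $\{St(K_n,\mathcal{A}_n):n\in\omega\}\in\mathscr{B}$. $\mathbf{SCS}_1(\mathscr{A},\mathscr{B})$: for any sequence $\{\mathcal{U}_n:n\in\omega\}$ of elements of $\mathscr{A}$ there is a sequence $\{x_n:n\in\omega\}$ of elements of $X$ such that $\bigcup\{\mathcal{V}_n:n\in\omega\}\in\mathscr{B}$, where $\mathcal{V}_n=\{\bigcup\mathcal{V}:\mathcal{V}\in[\mathcal{U}_n]^{<\omega}\text{ and }x_n\in V\text{ for each }V\in\mathcal{V}\}$. $\mathbf{SCS}_{fin}(\mathscr{A},\mathscr{B})$: for any sequence $\{\mathcal{U}_n:n\in\omega\}$ of elements of $\mathscr{A}$ there is a sequence $\{U_n^f:n\in\omega\}$ such that, for each $n\in\omega$, $U_n^f=\{x_n^1,\dots,x_n^{k_n}\}$ is a finite subset of $X$, and $\bigcup\{\mathcal{V}_n^i:n\in\omega\text{ and }i\in\{1,\dots,k_n\}\}\in\mathscr{B}$, where $\mathcal{V}_n^i=\{\bigcup\mathcal{V}:\mathcal{V}\in[\mathcal{U}_n]^{<\omega}\text{ and }x_n^i\in V\text{ for each }V\in\mathcal{V}\}$. *)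

theory Defs
  imports Main
begin

definition St :: "'a set \<Rightarrow> 'a set set \<Rightarrow> 'a set" where
  "St A \<U> = \<Union>{U \<in> \<U>. U \<inter> A \<noteq> {}}"

definition refines :: "'a set set \<Rightarrow> 'a set set \<Rightarrow> bool"  (infix "\<prec>" 50) where
  "\<A> \<prec> \<B> \<longleftrightarrow> (\<forall>A\<in>\<A>. \<exists>B\<in>\<B>. A \<subseteq> B)"

definition R_minus :: "'a set \<Rightarrow> 'a set set set \<Rightarrow> 'a set set set" where
  "R_minus X \<BB> = {\<R>. \<R> \<subseteq> Pow X \<and> (\<exists>\<B>\<in>\<BB>. \<R> \<prec> \<B>)}"

definition R_plus :: "'a set \<Rightarrow> 'a set set set \<Rightarrow> 'a set set set" where
  "R_plus X \<BB> = {\<R>. \<R> \<subseteq> Pow X \<and> (\<exists>\<B>\<in>\<BB>. \<B> \<prec> \<R>)}"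

definition SS1_star :: "'a set \<Rightarrow> 'a set set set \<Rightarrow> 'a set set set \<Rightarrow> bool" where
  "SS1_star X \<AA> \<BB> \<longleftrightarrow>
     (\<forall>\<A> :: nat \<Rightarrow> 'a set set. (\<forall>n. \<A> n \<in> \<AA>) \<longrightarrow>
        (\<exists>x :: nat \<Rightarrow> 'a. (\<forall>n. x n \<in> X) \<and> {St {x n} (\<A> n) | n. True} \<in> \<BB>))"

definition SSfin_star :: "'a set \<Rightarrow> 'a set set set \<Rightarrow> 'a set set set \<Rightarrow> bool" where
  "SSfin_star X \<AA> \<BB> \<longleftrightarrow>
     (\<forall>\<A> :: nat \<Rightarrow> 'a set set. (\<forall>n. \<A> n \<in> \<AA>) \<longrightarrow>
        (\<exists>K :: nat \<Rightarrow> 'a set. (\<forall>n. finite (K n) \<and> K n \<subseteq> X) \<and>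
           {St (K n) (\<A> n) | n. True} \<in> \<BB>))"

(* The empty subfamily is admitted, so the empty set always belongs to finite_unions_at x U. *)
definition finite_unions_at :: "'a \<Rightarrow> 'a set set \<Rightarrow> 'a set set" where
  "finite_unions_at x \<U> = {\<Union>\<V> | \<V>. finite \<V> \<and> \<V> \<subseteq> \<U> \<and> (\<forall>V\<in>\<V>. x \<in> V)}"

definition SCS1 :: "'a set \<Rightarrow> 'a set set set \<Rightarrow> 'a set set set \<Rightarrow> bool" where
  "SCS1 X \<AA> \<BB> \<longleftrightarrow>
     (\<forall>\<U> :: nat \<Rightarrow> 'a set set. (\<forall>n. \<U> n \<in> \<AA>) \<longrightarrow>
        (\<exists>x :: nat \<Rightarrow> 'a. (\<forall>n. x n \<in> X) \<and> (\<Union>n. finite_unions_at (x n) (\<U> n)) \<in> \<BB>))"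

(* F n is the finite set enumerated as x n 1, ..., x n (k n); k n = 0 gives the empty set. *)
definition SCSfin :: "'a set \<Rightarrow> 'a set set set \<Rightarrow> 'a set set set \<Rightarrow> bool" where
  "SCSfin X \<AA> \<BB> \<longleftrightarrow>
     (\<forall>\<U> :: nat \<Rightarrow> 'a set set. (\<forall>n. \<U> n \<in> \<AA>) \<longrightarrow>
        (\<exists>(F :: nat \<Rightarrow> 'a set) (k :: nat \<Rightarrow> nat) (x :: nat \<Rightarrow> nat \<Rightarrow> 'a).
           (\<forall>n. F n = x n ` {1..k n} \<and> F n \<subseteq> X) \<and>
           (\<Union>n. \<Union>i\<in>{1..k n}. finite_unions_at (x n i) (\<U> n)) \<in> \<BB>))"

end

theory Submission
  imports Defs
begin

text \<open>
  Everything rests on one containment: a union of members of \<open>\<U>\<close> that all contain a point \<open>x\<close>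
  is contained in \<open>St K \<U>\<close> for every \<open>K\<close> containing \<open>x\<close> (lemma \<open>finite_unions_at_subset_St\<close>).
  Hence, for the same choice of points, the family of local finite unions refines the family of
  stars.  If the stars form a member of \<open>\<BB>\<close>, the local unions form a family refining that member;
  if the local unions form a member of \<open>\<BB>\<close>, the stars form a family refined by it.  The points
  (or finite sets) chosen for one principle therefore serve for the other as well.
\<close>

lemma finite_unions_at_subset_St:
  assumes "W \<in> finite_unions_at x \<U>" and "x \<in> K"
  shows "W \<subseteq> St K \<U>"
  using assms unfolding finite_unions_at_def St_def by blast

lemma finite_unions_at_subset_Pow:
  assumes "\<U> \<subseteq> Pow X"
  shows "finite_unions_at x \<U> \<subseteq> Pow X"
  using assms unfolding finite_unions_at_def by blast

lemma St_subset:
  assumes "\<U> \<subseteq> Pow X"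
  shows "St K \<U> \<subseteq> X"
  using assms unfolding St_def by blast

text \<open>
  This form, with a set \<open>K n\<close> of points for each \<open>n\<close>, covers both the singleton and the finite
  versions of the principles.  Indices with \<open>K n = {}\<close> contribute nothing on the left.
\<close>

lemma finite_unions_refine_stars:
  "(\<Union>n. \<Union>x\<in>K n. finite_unions_at x (\<U> n)) \<prec> {St (K n) (\<U> n) | n. True}"
  unfolding refines_def
proof
  fix W assume "W \<in> (\<Union>n. \<Union>x\<in>K n. finite_unions_at x (\<U> n))"
  then obtain n x where "x \<in> K n" "W \<in> finite_unions_at x (\<U> n)" by blast
  then have "W \<subseteq> St (K n) (\<U> n)" by (simp add: finite_unions_at_subset_St)
  then show "\<exists>B\<in>{St (K n) (\<U> n) | n. True}. W \<subseteq> B" by blast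
qed

lemma finite_unions_in_R_minus:
  assumes "\<And>n. \<U> n \<subseteq> Pow X" and "{St (K n) (\<U> n) | n. True} \<in> \<BB>"
  shows "(\<Union>n. \<Union>x\<in>K n. finite_unions_at x (\<U> n)) \<in> R_minus X \<BB>"
proof -
  have "(\<Union>n. \<Union>x\<in>K n. finite_unions_at x (\<U> n)) \<subseteq> Pow X"
    by (intro UN_least finite_unions_at_subset_Pow assms(1))
  then show ?thesis
    using assms(2) finite_unions_refine_stars[where K = K and \<U> = \<U>] unfolding R_minus_def by blast
qed

lemma stars_in_R_plus:
  assumes "\<And>n. \<U> n \<subseteq> Pow X" and "(\<Union>n. \<Union>x\<in>K n. finite_unions_at x (\<U> n)) \<in> \<BB>"
  shows "{St (K n) (\<U> n) | n. True} \<in> R_plus X \<BB>"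
proof -
  have "{St (K n) (\<U> n) | n. True} \<subseteq> Pow X"
    using St_subset[OF assms(1)] by blast
  then show ?thesis
    using assms(2) finite_unions_refine_stars[where K = K and \<U> = \<U>] unfolding R_plus_def by blast
qed

lemma SS1_star_imp_SCS1:
  assumes "\<AA> \<subseteq> Pow (Pow X)" and "SS1_star X \<AA> \<BB>"
  shows "SCS1 X \<AA> (R_minus X \<BB>)"
  unfolding SCS1_def
proof (intro allI impI)
  fix \<U> :: "nat \<Rightarrow> 'a set set" assume \<U>: "\<forall>n. \<U> n \<in> \<AA>"
  then obtain x where x: "\<forall>n. x n \<in> X" "{St {x n} (\<U> n) | n. True} \<in> \<BB>"
    using assms(2)[unfolded SS1_star_def, rule_format, of \<U>] by blast
  have "\<U> n \<subseteq> Pow X" for n using \<U> assms(1) by blast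
  from finite_unions_in_R_minus[OF this x(2)] x(1)
  show "\<exists>x. (\<forall>n. x n \<in> X) \<and> (\<Union>n. finite_unions_at (x n) (\<U> n)) \<in> R_minus X \<BB>"
    by auto
qed

lemma SCS1_imp_SS1_star:
  assumes "\<AA> \<subseteq> Pow (Pow X)" and "SCS1 X \<AA> \<BB>"
  shows "SS1_star X \<AA> (R_plus X \<BB>)"
  unfolding SS1_star_def
proof (intro allI impI)
  fix \<U> :: "nat \<Rightarrow> 'a set set" assume \<U>: "\<forall>n. \<U> n \<in> \<AA>"
  then obtain x where x: "\<forall>n. x n \<in> X" "(\<Union>n. finite_unions_at (x n) (\<U> n)) \<in> \<BB>"
    using assms(2)[unfolded SCS1_def, rule_format, of \<U>] by blast
  have "\<U> n \<subseteq> Pow X" for n using \<U> assms(1) by blast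
  then have "{St {x n} (\<U> n) | n. True} \<in> R_plus X \<BB>"
    using x(2) by (intro stars_in_R_plus) simp_all
  with x(1) show "\<exists>x. (\<forall>n. x n \<in> X) \<and> {St {x n} (\<U> n) | n. True} \<in> R_plus X \<BB>"
    by blast
qed

lemma SSfin_star_imp_SCSfin:
  assumes "\<AA> \<subseteq> Pow (Pow X)" and "SSfin_star X \<AA> \<BB>"
  shows "SCSfin X \<AA> (R_minus X \<BB>)"
  unfolding SCSfin_def
proof (intro allI impI)
  fix \<U> :: "nat \<Rightarrow> 'a set set" assume \<U>: "\<forall>n. \<U> n \<in> \<AA>"
  then obtain K where K: "\<forall>n. finite (K n) \<and> K n \<subseteq> X" "{St (K n) (\<U> n) | n. True} \<in> \<BB>"
    using assms(2)[unfolded SSfin_star_def, rule_format, of \<U>] by blast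
  have "\<exists>h. bij_betw h {1..card (K n)} (K n)" for n
    using K(1) ex_bij_betw_nat_finite_1 by blast
  then have "\<forall>n. \<exists>h. bij_betw h {1..card (K n)} (K n)" by blast
  from choice[OF this] obtain x where x: "\<forall>n. bij_betw (x n) {1..card (K n)} (K n)" by blast
  have enum: "K n = x n ` {1..card (K n)}" for n
    by (rule bij_betw_imp_surj_on[OF x[rule_format], symmetric])
  have "\<U> n \<subseteq> Pow X" for n using \<U> assms(1) by blast
  then have "(\<Union>n. \<Union>y\<in>K n. finite_unions_at y (\<U> n)) \<in> R_minus X \<BB>"
    by (rule finite_unions_in_R_minus) (rule K(2))
  moreover have "(\<Union>y\<in>K n. finite_unions_at y (\<U> n)) =
      (\<Union>i\<in>{1..card (K n)}. finite_unions_at (x n i) (\<U> n))" for n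
  proof -
    have "(\<Union>y\<in>x n ` {1..card (K n)}. finite_unions_at y (\<U> n)) =
        (\<Union>i\<in>{1..card (K n)}. finite_unions_at (x n i) (\<U> n))"
      by (simp only: image_image)
    then show ?thesis by (simp only: enum[symmetric])
  qed
  ultimately have
    "(\<Union>n. \<Union>i\<in>{1..card (K n)}. finite_unions_at (x n i) (\<U> n)) \<in> R_minus X \<BB>"
    by simp
  moreover have "\<forall>n. K n = x n ` {1..card (K n)} \<and> K n \<subseteq> X"
    by (intro allI conjI enum) (simp add: K(1))
  ultimately show "\<exists>F (k :: nat \<Rightarrow> nat) x. (\<forall>n. F n = x n ` {1..k n} \<and> F n \<subseteq> X) \<and>
      (\<Union>n. \<Union>i\<in>{1..k n}. finite_unions_at (x n i) (\<U> n)) \<in> R_minus X \<BB>"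
    by (intro exI[of _ K] exI[of _ "\<lambda>n. card (K n)"] exI[of _ x] conjI)
qed

lemma SCSfin_imp_SSfin_star:
  assumes "\<AA> \<subseteq> Pow (Pow X)" and "SCSfin X \<AA> \<BB>"
  shows "SSfin_star X \<AA> (R_plus X \<BB>)"
  unfolding SSfin_star_def
proof (intro allI impI)
  fix \<U> :: "nat \<Rightarrow> 'a set set" assume \<U>: "\<forall>n. \<U> n \<in> \<AA>"
  with assms(2)[unfolded SCSfin_def, rule_format, of \<U>]
  obtain F k x where F: "\<forall>n. F n = x n ` {1..k n} \<and> F n \<subseteq> X"
    and B: "(\<Union>n. \<Union>i\<in>{1..k n :: nat}. finite_unions_at (x n i) (\<U> n)) \<in> \<BB>"
    by blast
  have "(\<Union>y\<in>F n. finite_unions_at y (\<U> n)) =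
      (\<Union>i\<in>{1..k n}. finite_unions_at (x n i) (\<U> n))" for n
    by (simp only: F image_image)
  with B have "(\<Union>n. \<Union>y\<in>F n. finite_unions_at y (\<U> n)) \<in> \<BB>" by simp
  moreover have "\<U> n \<subseteq> Pow X" for n using \<U> assms(1) by blast
  ultimately have "{St (F n) (\<U> n) | n. True} \<in> R_plus X \<BB>"
    by (intro stars_in_R_plus)
  moreover have "\<forall>n. finite (F n) \<and> F n \<subseteq> X"
    using F by (metis finite_atLeastAtMost finite_imageI)
  ultimately show "\<exists>K. (\<forall>n. finite (K n) \<and> K n \<subseteq> X) \<and>
      {St (K n) (\<U> n) | n. True} \<in> R_plus X \<BB>"
    by blast
qed

theorem theorem3p6:
  fixes X :: "'a set" and \<AA> \<BB> :: "'a set set set"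
  assumes "\<AA> \<subseteq> Pow (Pow X)" and "\<BB> \<subseteq> Pow (Pow X)"
  shows "(SS1_star X \<AA> \<BB> \<longrightarrow> SCS1 X \<AA> (R_minus X \<BB>)) \<and>
         (SCS1 X \<AA> \<BB> \<longrightarrow> SS1_star X \<AA> (R_plus X \<BB>)) \<and>
         (SSfin_star X \<AA> \<BB> \<longrightarrow> SCSfin X \<AA> (R_minus X \<BB>)) \<and>
         (SCSfin X \<AA> \<BB> \<longrightarrow> SSfin_star X \<AA> (R_plus X \<BB>))"
  using SS1_star_imp_SCS1[OF assms(1)] SCS1_imp_SS1_star[OF assms(1)]
    SSfin_star_imp_SCSfin[OF assms(1)] SCSfin_imp_SSfin_star[OF assms(1)]
  by blast

end
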